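(* Let $Q$ be a positive integer, let $x$ be the least common multiple of $1,2,\dots,Q$, and let $X=(X_{mn})_{m,n=1}^x$ be the $x\times x$ matrix with $X_{mn}=\sum_{q=1}^Q c_q(m-n)$. Then the characteristic polynomial of $X$ is \[ \det(\lambda E_x-X)=\lambda^{x-\Phi(Q)}(\lambda-x)^{\Phi(Q)}. \] In particular, $X$ has eigenvalues $0$ and $x$ with multiplicities $x-\Phi(Q)$ and $\Phi(Q)$, respectively.
   Context: For a positive integer $q$ and any integer $n$, the Ramanujan sum is $c_q(n)=\sum_{1\le k\le q,\ \gcd(k,q)=1}\exp(2\pi i kn/q)$. $\varphi$ is Euler's totient function, $\Phi(Q)=\sum_{q=1}^Q\varphi(q)$, and $E_x$ is the $x\times x$ identity matrix. *)

theory Defs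
  imports "Jordan_Normal_Form.Char_Poly" "HOL-Number_Theory.Totient"
begin

definition ramanujan_sum :: "nat \<Rightarrow> int \<Rightarrow> complex" where
  "ramanujan_sum q n =
     (\<Sum>k\<in>{k\<in>{1..q}. coprime k q}. exp (2 * of_real pi * \<i> * of_nat k * of_int n / of_nat q))"

definition totient_sum :: "nat \<Rightarrow> nat" where
  "totient_sum Q = (\<Sum>q = 1..Q. totient q)"

text \<open>Matrix entries are indexed from 0 here rather than from 1;
  since an entry depends only on the difference of its indices, this is the same matrix.\<close>

definition ramanujan_mat :: "nat \<Rightarrow> complex mat" where
  "ramanujan_mat Q =
     (let x = Lcm {1..Q}
      in mat x x (\<lambda>(m, n). \<Sum>q = 1..Q. ramanujan_sum q (int m - int n)))"

end

theory Submission 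
  imports "HOL-Analysis.Complex_Transcendental" Defs
begin

text \<open>As \<open>q\<close> runs over \<open>1, \<dots>, Q\<close> and \<open>k\<close> over the residues coprime to \<open>q\<close>, the fractions \<open>k/q\<close> are
  pairwise distinct (they are in lowest terms), and each is of the form \<open>j/x\<close> with \<open>1 \<le> j \<le> x\<close>.
  Hence \<open>X\<close> has entries \<open>\<Sum>j\<in>S. exp (2\<pi>i j(m - n)/x)\<close> for a set \<open>S\<close> of \<open>\<Phi>(Q)\<close> frequencies.
  It is diagonalised by the discrete Fourier transform of order \<open>x\<close>, with eigenvalue
  \<open>x\<close> at the frequencies in \<open>S\<close> and \<open>0\<close> at the others.\<close>

section \<open>Additive characters modulo \<open>N\<close> and their orthogonality\<close>

definition unit_exp :: "nat \<Rightarrow> int \<Rightarrow> complex" where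
  "unit_exp N a = exp (2 * of_real pi * \<i> * of_int a / of_nat N)"

lemma unit_exp_add: "unit_exp N (a + b) = unit_exp N a * unit_exp N b"
  by (simp add: unit_exp_def exp_add [symmetric] add_divide_distrib distrib_left)

lemma unit_exp_0 [simp]: "unit_exp N 0 = 1"
  by (simp add: unit_exp_def)

lemma unit_exp_power: "unit_exp N a ^ k = unit_exp N (int k * a)"
  by (simp add: unit_exp_def exp_of_nat_mult [symmetric] mult_ac)

lemma unit_exp_eq_1_iff:
  assumes "N > 0"
  shows "unit_exp N a = 1 \<longleftrightarrow> int N dvd a"
proof -
  have "unit_exp N a = 1 \<longleftrightarrow> (\<exists>k::int. 2 * pi * of_int a / of_nat N = of_int (2 * k) * pi)"
    by (simp add: unit_exp_def exp_eq_1)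
  also have "\<dots> \<longleftrightarrow> (\<exists>k. real_of_int a = real_of_int (int N * k))"
    using assms by (simp add: field_simps)
  also have "\<dots> \<longleftrightarrow> int N dvd a"
    by (simp only: of_int_eq_iff dvd_def)
  finally show ?thesis .
qed

text \<open>Serves to bring a phase with denominator \<open>q\<close> over a common
  denominator.\<close>

lemma unit_exp_cancel:
  assumes "d > 0"
  shows "unit_exp (q * d) (int d * a) = unit_exp q a"
  using assms by (simp add: unit_exp_def field_simps)

text \<open>A geometric series whose ratio is an \<open>N\<close>-th root of unity: the ratio is 1
  exactly when \<open>N\<close> divides \<open>a\<close>, and otherwise the numerator of the closed
  form vanishes. The exponents run over 1 to \<open>N\<close> to match the frequencies used
  later.\<close>

lemma sum_unit_exp:
  assumes "N > 0"
  shows "(\<Sum>j<N. unit_exp N (int (Suc j) * a)) = (if int N dvd a then of_nat N else 0)"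
proof -
  let ?z = "unit_exp N a"
  have "(\<Sum>j<N. unit_exp N (int (Suc j) * a)) = (\<Sum>j<N. ?z * ?z ^ j)"
    by (simp only: unit_exp_power [symmetric] power_Suc)
  also have "\<dots> = ?z * (\<Sum>j<N. ?z ^ j)"
    by (simp add: sum_distrib_left)
  also have "\<dots> = (if int N dvd a then of_nat N else 0)"
  proof (cases "int N dvd a")
    case True
    then have "?z = 1" using unit_exp_eq_1_iff [OF assms] by simp
    then show ?thesis using True by (simp only: power_one) simp
  next
    case False
    moreover have "?z ^ N = 1"
      by (simp add: unit_exp_power unit_exp_eq_1_iff [OF assms])
    ultimately show ?thesis
      using unit_exp_eq_1_iff [OF assms] by (simp add: geometric_sum)
  qed
  finally show ?thesis .
qed

section \<open>Diagonalisation by the discrete Fourier transform\<close>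

lemma char_poly_diagonal:
  fixes d :: "nat \<Rightarrow> 'a :: idom"
  shows "char_poly (mat N N (\<lambda>(i, j). if i = j then d i else 0)) = (\<Prod>j<N. [:- d j, 1:])"
proof -
  let ?D = "mat N N (\<lambda>(i, j). if i = j then d i else 0)"
  have "char_poly ?D = (\<Prod>a\<leftarrow>diag_mat ?D. [:- a, 1:])"
    by (rule char_poly_upper_triangular [of _ N]) (auto simp: upper_triangular_def)
  also have "diag_mat ?D = map d [0..<N]"
    by (simp add: diag_mat_def)
  also have "(\<Prod>a\<leftarrow>map d [0..<N]. [:- a, 1:]) = (\<Prod>j<N. [:- d j, 1:])"
    by (simp add: comp_def prod.distinct_set_conv_list [symmetric] lessThan_atLeast0)
  finally show ?thesis .
qed

lemma char_poly_unit_exp_mat: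
  assumes S: "S \<subseteq> {1..N}" and N: "N > 0"
  shows "char_poly (mat N N (\<lambda>(m, n). \<Sum>j\<in>S. unit_exp N (int j * (int m - int n)))) =
    [:0, 1:] ^ (N - card S) * [:- of_nat N, 1:] ^ card S"
proof -
  define X where "X = mat N N (\<lambda>(m, n). \<Sum>j\<in>S. unit_exp N (int j * (int m - int n)))"
  \<comment> \<open>Indices start at 0 but frequencies lie in \<open>{1..N}\<close>, so index
    \<open>j\<close> stands for frequency \<open>Suc j\<close>.\<close>
  define d :: "nat \<Rightarrow> complex" where "d j = (if Suc j \<in> S then of_nat N else 0)" for j
  define D where "D = mat N N (\<lambda>(i, j). if i = j then d i else 0)"
  define F where "F = mat N N (\<lambda>(m, j). unit_exp N (int (Suc j) * int m))"
  \<comment> \<open>\<open>G\<close> is the conjugate transpose of \<open>F\<close> divided by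
    \<open>N\<close>; it carries the whole normalisation, so no square root of \<open>N\<close>
    appears.\<close>
  define G where "G = mat N N (\<lambda>(j, n). unit_exp N (int (Suc j) * - int n) / of_nat N)"
  have carrier: "X \<in> carrier_mat N N" "D \<in> carrier_mat N N" "F \<in> carrier_mat N N"
    "G \<in> carrier_mat N N"
    by (simp_all add: X_def D_def F_def G_def)
  have phase: "unit_exp N (int (Suc j) * int m) * (unit_exp N (int (Suc j) * - int n) / of_nat N)
      = unit_exp N (int (Suc j) * (int m - int n)) / of_nat N" for j m n
    unfolding times_divide_eq_right unit_exp_add [symmetric] distrib_left [symmetric] by simp
  have FG: "F * G = 1\<^sub>m N"
  proof (rule eq_matI)
    fix m n assume "m < dim_row (1\<^sub>m N :: complex mat)" "n < dim_col (1\<^sub>m N :: complex mat)"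
    then have mn: "m < N" "n < N" by auto
    have "(F * G) $$ (m, n) = (\<Sum>j<N. unit_exp N (int (Suc j) * (int m - int n)) / of_nat N)"
      using mn
      by (simp add: F_def G_def scalar_prod_def lessThan_atLeast0 del: of_nat_Suc
          add: phase [unfolded times_divide_eq_right mult_minus_right])
    also have "\<dots> = (if int N dvd int m - int n then 1 else 0)"
      using N by (simp only: sum_divide_distrib [symmetric] sum_unit_exp) simp
    \<comment> \<open>Both indices are below \<open>N\<close>, so congruence modulo \<open>N\<close>
      forces equality.\<close>
    also have "int N dvd int m - int n \<longleftrightarrow> m = n"
      using mn by (simp add: mod_eq_dvd_iff [symmetric])
    finally show "(F * G) $$ (m, n) = 1\<^sub>m N $$ (m, n)"
      using mn by simp
  qed (auto simp: F_def G_def)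
  have GF: "G * F = 1\<^sub>m N"
    by (rule mat_mult_left_right_inverse [OF carrier(3,4) FG])
  have FD: "F * D = mat N N (\<lambda>(m, j). unit_exp N (int (Suc j) * int m) * d j)"
    by (rule eq_matI)
      (auto simp: F_def D_def scalar_prod_def if_distrib [of "(*) _"] sum.delta cong: if_cong)
  have X: "X = F * D * G"
  proof (rule eq_matI)
    fix m n assume "m < dim_row (F * D * G)" "n < dim_col (F * D * G)"
    then have mn: "m < N" "n < N" using carrier by auto
    have "(F * D * G) $$ (m, n) =
        (\<Sum>j<N. d j * (unit_exp N (int (Suc j) * int m) * (unit_exp N (int (Suc j) * - int n) / of_nat N)))"
      using mn unfolding FD
      by (simp add: G_def scalar_prod_def lessThan_atLeast0 mult_ac del: of_nat_Suc)
    \<comment> \<open>The nonzero value \<open>N\<close> of \<open>d j\<close> cancels the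
      \<open>1/N\<close> from \<open>G\<close>.\<close>
    also have "\<dots> = (\<Sum>j<N. if Suc j \<in> S then unit_exp N (int (Suc j) * (int m - int n)) else 0)"
      unfolding phase using N by (intro sum.cong) (auto simp: d_def)
    also have "\<dots> = (\<Sum>j\<in>{1..N}. if j \<in> S then unit_exp N (int j * (int m - int n)) else 0)"
      by (rule sum.reindex_bij_witness [of _ "\<lambda>j. j - 1" Suc]) auto
    also have "\<dots> = (\<Sum>j\<in>S. unit_exp N (int j * (int m - int n)))"
      using S by (simp add: sum.inter_restrict [symmetric] Int_absorb1)
    finally show "X $$ (m, n) = (F * D * G) $$ (m, n)"
      using mn by (simp add: X_def)
  qed (auto simp: X_def F_def G_def)
  have "similar_mat X D"
    unfolding similar_mat_def similar_mat_wit_def using X FG GF carrier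
    by (intro exI [of _ F] exI [of _ G]) (auto simp: Let_def)
  then have "char_poly X = char_poly D"
    by (rule char_poly_similar)
  also have "\<dots> = (\<Prod>j<N. [:- d j, 1:])"
    unfolding D_def by (rule char_poly_diagonal)
  also have "\<dots> = (\<Prod>j\<in>{1..N}. if j \<in> S then [:- of_nat N, 1:] else [:0, 1:])"
    by (rule prod.reindex_bij_witness [of _ "\<lambda>j. j - 1" Suc]) (auto simp: d_def)
  also have "\<dots> = [:- of_nat N, 1:] ^ card S * [:0, 1:] ^ card ({1..N} - S)"
    using S by (simp add: prod.If_cases Int_absorb1 Diff_eq)
  also have "card ({1..N} - S) = N - card S"
    using S by (simp add: card_Diff_subset finite_subset)
  finally show ?thesis
    by (simp add: X_def mult.commute)
qed

section \<open>Reduced fractions with denominator at most \<open>Q\<close> as frequencies\<close>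

definition reduced_fractions :: "nat \<Rightarrow> (nat \<times> nat) set" where
  "reduced_fractions Q = (SIGMA q:{1..Q}. totatives q)"

text \<open>The numerator of \<open>k/q\<close> over the denominator \<open>x\<close>, when
  \<open>q\<close> divides \<open>x\<close>.\<close>

definition frequency :: "nat \<Rightarrow> nat \<times> nat \<Rightarrow> nat" where
  "frequency x = (\<lambda>(q, k). k * (x div q))"

lemma Lcm_upto_pos: "Lcm {1..Q :: nat} > 0"
  by (simp add: Lcm_0_iff_nat flip: neq0_conv)

text \<open>Equal frequencies mean \<open>k/q = k'/q'\<close>, and a fraction has only one form in
  lowest terms.\<close>

lemma inj_on_frequency: "inj_on (frequency (Lcm {1..Q})) (reduced_fractions Q)"
proof (rule inj_onI, clarify)
  fix q k q' k'
  assume qk: "(q, k) \<in> reduced_fractions Q" "(q', k') \<in> reduced_fractions Q"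
    and eq: "frequency (Lcm {1..Q}) (q, k) = frequency (Lcm {1..Q}) (q', k')"
  define x where "x = Lcm {1..Q}"
  have x: "x > 0" unfolding x_def by (rule Lcm_upto_pos)
  have "q dvd x" "q' dvd x"
    using qk by (auto simp: x_def reduced_fractions_def intro!: dvd_Lcm)
  \<comment> \<open>Multiplying by \<open>q * q'\<close> turns both truncated quotients into
    \<open>x\<close>, which then cancels.\<close>
  have "k * x * q' = (k * (x div q)) * q * q'"
    using \<open>q dvd x\<close> by simp
  also have "k * (x div q) = k' * (x div q')"
    using eq by (simp add: frequency_def x_def)
  also have "(k' * (x div q')) * q * q' = k' * (x div q' * q') * q"
    by (simp only: mult_ac)
  also have "\<dots> = k' * x * q"
    using \<open>q' dvd x\<close> by simp
  finally have "k * q' = k' * q"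
    using x by (simp add: mult_ac)
  moreover have "coprime k q" "coprime k' q'"
    using qk by (auto simp: reduced_fractions_def totatives_def)
  ultimately show "q = q' \<and> k = k'"
    using coprime_crossproduct_nat [of k q k' q'] by (auto simp: mult_ac)
qed

text \<open>The fractions satisfy \<open>0 < k/q \<le> 1\<close>; the value 1, from
  \<open>q = k = 1\<close>, gives the frequency \<open>x\<close>.\<close>

lemma frequency_subset: "frequency (Lcm {1..Q}) ` reduced_fractions Q \<subseteq> {1..Lcm {1..Q}}"
proof clarify
  fix q k
  assume qk: "(q, k) \<in> reduced_fractions Q"
  define x where "x = Lcm {1..Q}"
  have x: "x > 0" unfolding x_def by (rule Lcm_upto_pos)
  have q: "q dvd x"
    using qk by (auto simp: x_def reduced_fractions_def intro!: dvd_Lcm)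
  have k: "0 < k" "k \<le> q"
    using qk by (auto simp: reduced_fractions_def totatives_def)
  have "k * (x div q) \<le> q * (x div q)"
    using k by (intro mult_right_mono) auto
  moreover have "x div q > 0"
    using q x by (simp add: dvd_imp_le div_greater_zero_iff k order_less_le_trans [OF k])
  ultimately show "frequency (Lcm {1..Q}) (q, k) \<in> {1..Lcm {1..Q}}"
    using q k unfolding x_def [symmetric] frequency_def by simp
qed

lemma card_frequency: "card (frequency (Lcm {1..Q}) ` reduced_fractions Q) = totient_sum Q"
proof -
  have "card (frequency (Lcm {1..Q}) ` reduced_fractions Q) = card (reduced_fractions Q)"
    by (rule card_image [OF inj_on_frequency])
  also have "\<dots> = totient_sum Q"
    by (simp add: reduced_fractions_def totient_sum_def totient_def)
  finally show ?thesis .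
qed

text \<open>All phases are put over the denominator \<open>x\<close>; injectivity of
  \<open>frequency\<close> then turns the double sum into a sum over a set, each frequency occurring
  once.\<close>

lemma sum_ramanujan_sum:
  "(\<Sum>q = 1..Q. ramanujan_sum q a) =
   (\<Sum>j\<in>frequency (Lcm {1..Q}) ` reduced_fractions Q. unit_exp (Lcm {1..Q}) (int j * a))"
proof -
  define x where "x = Lcm {1..Q}"
  have x: "x > 0" unfolding x_def by (rule Lcm_upto_pos)
  have "unit_exp x (int (frequency x (q, k)) * a) = exp (2 * of_real pi * \<i> * of_nat k * of_int a / of_nat q)"
    if "q \<in> {1..Q}" for q k
  proof -
    have q: "q * (x div q) = x"
      using that by (auto simp: x_def intro!: dvd_Lcm dvd_mult_div_cancel)
    then have "x div q > 0"
      using x by (metis mult_0_right neq0_conv)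
    from unit_exp_cancel [OF this, of q "int k * a"] show ?thesis
      unfolding q by (simp add: frequency_def unit_exp_def mult_ac)
  qed
  moreover have "totatives q = {k \<in> {1..q}. coprime k q}" for q
    by (auto simp: totatives_def)
  ultimately have "(\<Sum>q = 1..Q. ramanujan_sum q a) =
      (\<Sum>q = 1..Q. \<Sum>k\<in>totatives q. unit_exp x (int (frequency x (q, k)) * a))"
    unfolding ramanujan_sum_def by (intro sum.cong) auto
  also have "\<dots> = (\<Sum>p\<in>reduced_fractions Q. unit_exp x (int (frequency x p) * a))"
    unfolding reduced_fractions_def by (subst sum.Sigma) (auto intro: sum.cong)
  also have "\<dots> = (\<Sum>j\<in>frequency x ` reduced_fractions Q. unit_exp x (int j * a))"
    using inj_on_frequency [of Q] by (simp add: sum.reindex x_def)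
  finally show ?thesis
    by (simp add: x_def)
qed

section \<open>Multiplicities and eigenvalues\<close>

lemma order_linear_factors:
  fixes a b :: "'a :: idom"
  assumes "a \<noteq> b"
  shows "order a ([:- a, 1:] ^ m * [:- b, 1:] ^ n) = m"
proof -
  \<comment> \<open>\<open>a\<close> is no root of this factor, so only the other one contributes to
    the order.\<close>
  have "order a ([:- b, 1:] ^ n) = 0"
    using assms by (intro order_0I) simp
  moreover have "[:- a, 1:] ^ m * [:- b, 1:] ^ n \<noteq> 0"
    by simp
  ultimately show ?thesis
    using order_mult [of "[:- a, 1:] ^ m" "[:- b, 1:] ^ n" a] order_power_n_n [of a m] by simp
qed

theorem theorem2:
  fixes Q x :: nat and X :: "complex mat"
  assumes "Q > 0"
  defines "x \<equiv> Lcm {1..Q}"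
  defines "X \<equiv> ramanujan_mat Q"
  shows "totient_sum Q \<le> x
    \<and> char_poly X = [:0, 1:] ^ (x - totient_sum Q) * [:- of_nat x, 1:] ^ totient_sum Q
    \<and> order 0 (char_poly X) = x - totient_sum Q
    \<and> order (of_nat x) (char_poly X) = totient_sum Q
    \<and> (\<forall>\<mu>. eigenvalue X \<mu> \<longleftrightarrow> \<mu> = of_nat x \<or> \<mu> = 0 \<and> totient_sum Q < x)"
proof -
  define S where "S = frequency x ` reduced_fractions Q"
  have x: "x > 0" unfolding x_def by (rule Lcm_upto_pos)
  have S: "S \<subseteq> {1..x}" "card S = totient_sum Q"
    unfolding S_def x_def by (rule frequency_subset, rule card_frequency)
  \<comment> \<open>This makes the natural-number subtraction \<open>x - totient_sum Q\<close> a
    true difference.\<close>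
  have le: "totient_sum Q \<le> x"
    using card_mono [OF _ S(1)] S(2) by simp
  have X: "X = mat x x (\<lambda>(m, n). \<Sum>j\<in>S. unit_exp x (int j * (int m - int n)))"
    unfolding X_def ramanujan_mat_def sum_ramanujan_sum S_def x_def Let_def ..
  have cp: "char_poly X = [:0, 1:] ^ (x - totient_sum Q) * [:- of_nat x, 1:] ^ totient_sum Q"
    unfolding X using char_poly_unit_exp_mat [OF S(1) x] S(2) by simp
  \<comment> \<open>The term \<open>q = 1\<close> keeps the exponent of the factor for
    \<open>x\<close> positive, so \<open>x\<close> is indeed an eigenvalue.\<close>
  have "totient 1 \<le> totient_sum Q"
    unfolding totient_sum_def using \<open>Q > 0\<close> by (intro member_le_sum) auto
  then have pos: "totient_sum Q > 0"
    by simp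
  have ord0: "order 0 (char_poly X) = x - totient_sum Q"
    unfolding cp using order_linear_factors [of 0 "of_nat x :: complex"] x by simp
  have ordx: "order (of_nat x) (char_poly X) = totient_sum Q"
    unfolding cp using order_linear_factors [of "of_nat x :: complex" 0] x
    by (simp add: mult.commute)
  have "X \<in> carrier_mat x x"
    by (simp add: X)
  then have "eigenvalue X \<mu> \<longleftrightarrow> poly (char_poly X) \<mu> = 0" for \<mu>
    by (rule eigenvalue_root_char_poly)
  \<comment> \<open>The exponent of \<open>[:0, 1:]\<close> can be 0, as for \<open>Q = 1\<close>
    and \<open>Q = 2\<close>; hence the side condition on the eigenvalue 0.\<close>
  then have ev: "eigenvalue X \<mu> \<longleftrightarrow> \<mu> = of_nat x \<or> \<mu> = 0 \<and> totient_sum Q < x" for \<mu>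
    unfolding cp using pos by auto
  show ?thesis
    using le cp ord0 ordx ev by blast
qed

end
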